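(* Let $N_x\ge3$, $r\ge1$ with $4r+1\le\min(N_x,N_\mu)$, $\Delta x=1/N_x$, $\Delta t>0$, $\sigma\ge0$. Let $\mathbf B^0\in\mathbb R^{N_x}$ have nonzero entries and let $\mathbf v^0=\mathbf X^0\mathbf S^0\mathbf V^{0,\top}$, i.e. $v_{jk}^0=\sum_{m,n=1}^rX_{jm}^0S_{mn}^0V_{kn}^0$, be a rank-$r$ representation ($\mathbf X^0\in\mathbb R^{N_x\times r}$, $\mathbf V^0\in\mathbb R^{N_\mu\times r}$ with orthonormal columns, $\mathbf S^0\in\mathbb R^{r\times r}$). Let $\mathbf B^1$ and $\mathbf X^1,\mathbf S^1,\mathbf V^1$ be the result of one (well-defined) time step of the dynamical low-rank (DLRA) scheme with conservative truncation for the multiplicative Su-Olson problem described in the context. Put $\Phi_j^0=(\mathbf X^0\mathbf S^0\mathbf V^{0,\top})_{j0}$ and $\Phi_j^1=(\mathbf X^1\mathbf S^1\mathbf V^{1,\top})_{j0}$. Then the scheme is locally mass conservative, i.e. for every $j=1,\dots,N_x$ it fulfills the local conservation law $$\frac{1}{\Delta t} \left(\sqrt{2} B_j^1 \Phi_j^1 + B_j^1 - \left( \sqrt{2} B_j^0 \Phi_j^0 + B_j^0\right) \right) = - \sqrt{2}\sum_{i=1}^{N_x} \sum_{\ell=0}^{N_\mu-1} D^x_{ji} B_i^0 v_{i\ell}^0 A_{0\ell}+ \sqrt{2} \sum_{i=1}^{N_x} \sum_{\ell=0}^{N_\mu-1} D^{xx}_{ji} B_i^0 v_{i\ell}^0 |A|_{0\ell}$$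 (a discretization of the continuous local conservation law $\partial_t\rho+\partial_xu=0$ for the mass $\rho=B\int_{-1}^1 g\,d\mu+B$ and momentum $u=B\int_{-1}^1\mu g\,d\mu$).
   Context: Indices: spatial $i,j\in\{1,\dots,N_x\}$ (periodic), angular $k,\ell\in\{0,\dots,N_\mu-1\}$ (columns/rows of angular objects are numbered from $0$). $\mathbf e_1\in\mathbb R^{N_\mu}$ is the first unit vector (corresponding to angular index $0$). The function $g(t,x,\mu)$ in the continuous conservation law is the factor in the multiplicative splitting $f=Bg$ of the particle density; $v_{jk}$ approximates its $k$-th Legendre moment at the grid point $x_j$. Angular matrices: $P_\ell$ is the Legendre polynomial of degree $\ell$ with $\int_{-1}^1P_kP_\ell\,d\mu=\delta_{k\ell}$; $\mathbf A\in\mathbb R^{N_\mu\times N_\mu}$, $A_{k\ell}=\int_{-1}^1\mu P_kP_\ell\,d\mu$, is symmetric, $\mathbf A=\mathbf Q\mathbf M\mathbf Q^\top$ with $\mathbf Q$ orthogonal, $\mathbf M$ diagonal; $|\mathbf A|:=\mathbf Q|\mathbf M|\mathbf Q^\top$. Stencil matrices $\mathbf D^x,\mathbf D^{xx}\in\mathbb R^{N_x\times N_x}$ (indices modulo $N_x$): $D^x_{j,j\pm1}=\frac{\pm1}{2\Delta x}$, $D^{xx}_{j,j}=-\frac1{\Delta x}$, $D^{xx}_{j,j\pm1}=\frac1{2\Delta x}$, all other entries $0$. Put $\mathbf G^x=\mathrm{diag}(\mathbf B^0)^{-1}\mathbf D^x\,\mathrm{diag}(\mathbf B^0)$ and $\mathbf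 G^{xx}=\mathrm{diag}(\mathbf B^0)^{-1}\mathbf D^{xx}\,\mathrm{diag}(\mathbf B^0)$. $\mathrm{qr}(\mathbf Z)$ denotes a matrix with orthonormal columns, as many as $\mathbf Z$ has, whose range contains the range of $\mathbf Z$ (the orthonormal factor of a QR decomposition), its first column being the normalized first column of $\mathbf Z$ when that is nonzero. One step of the DLRA scheme: 1. K-step. $\mathbf K^0=\mathbf X^0\mathbf S^0$, $\mathbf K^\ast=\frac1{1+\sigma\Delta t}\big(\mathbf K^0-\Delta t\,\mathbf G^x\mathbf K^0\mathbf V^{0,\top}\mathbf A\mathbf V^0+\Delta t\,\mathbf G^{xx}\mathbf K^0\mathbf V^{0,\top}|\mathbf A|\mathbf V^0\big)$; $\widehat{\mathbf X}^\ast=\mathrm{qr}([\mathbf K^\ast,\mathbf X^0])$ and $\widehat{\widehat{\mathbf X}}{}^\ast=\mathrm{qr}([\widehat{\mathbf X}^\ast,\mathbf G^x\mathbf X^0,\mathbf G^{xx}\mathbf X^0])\in\mathbb R^{N_x\times4r}$. 2. L-step. $\mathbf L^0=\mathbf V^0\mathbf S^{0,\top}$, $\mathbf L^\ast=\frac1{1+\sigma\Delta t}\big(\mathbf L^0-\Delta t\,\mathbf A\mathbf L^0\mathbf X^{0,\top}(\mathbf G^x)^\top\mathbf X^0+\Delta t\,|\mathbf A|\mathbf L^0\mathbf X^{0,\top}(\mathbf G^{xx})^\top\mathbf X^0\big)$; $\widehat{\mathbf V}^\ast=\mathrm{qr}([\mathbf L^\ast,\mathbf V^0])$ and $\widehat{\widehat{\mathbf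 V}}{}^\ast=\mathrm{qr}([\widehat{\mathbf V}^\ast,\mathbf A^\top\mathbf V^0,|\mathbf A|^\top\mathbf V^0])\in\mathbb R^{N_\mu\times4r}$. 3. S-step. $\widetilde{\mathbf S}^0=\big(\widehat{\widehat{\mathbf X}}{}^{\ast,\top}\mathbf X^0\big)\mathbf S^0\big(\widehat{\widehat{\mathbf V}}{}^{\ast,\top}\mathbf V^0\big)^\top$, $\widehat{\widehat{\mathbf S}}{}^\ast=\frac1{1+\sigma\Delta t}\big(\widetilde{\mathbf S}^0-\Delta t\,\widehat{\widehat{\mathbf X}}{}^{\ast,\top}\mathbf G^x\widehat{\widehat{\mathbf X}}{}^\ast\widetilde{\mathbf S}^0\widehat{\widehat{\mathbf V}}{}^{\ast,\top}\mathbf A\widehat{\widehat{\mathbf V}}{}^\ast+\Delta t\,\widehat{\widehat{\mathbf X}}{}^{\ast,\top}\mathbf G^{xx}\widehat{\widehat{\mathbf X}}{}^\ast\widetilde{\mathbf S}^0\widehat{\widehat{\mathbf V}}{}^{\ast,\top}|\mathbf A|\widehat{\widehat{\mathbf V}}{}^\ast\big)$. 4. Coupled update of zeroth moment and internal energy. $v_{j0}^1$ and $B_j^1$ solve, for every $j$, $\frac{B_j^1}{B_j^0}v_{j0}^1=\frac1{1+\sigma\Delta t}\Big(\big(\mathbf X^0\mathbf S^0\mathbf V^{0,\top}\big)_{j0}-\Delta t\big(\mathbf G^x\widehat{\widehat{\mathbf X}}{}^\ast\widetilde{\mathbf S}^0\widehat{\widehat{\mathbf V}}{}^{\ast,\top}\mathbf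 A\big)_{j0}+\Delta t\big(\mathbf G^{xx}\widehat{\widehat{\mathbf X}}{}^\ast\widetilde{\mathbf S}^0\widehat{\widehat{\mathbf V}}{}^{\ast,\top}|\mathbf A|\big)_{j0}+\sqrt2\,\sigma\Delta t\frac{B_j^1}{B_j^0}\Big)$, $\frac{B_j^1}{B_j^0}=1+\sigma\Delta t\frac{B_j^1}{B_j^0}\big(\sqrt2\,v_{j0}^1-2\big)$. The step is well-defined if such a solution exists (then $B_j^1\neq0$). Write $\mathbf v_0^1=(v_{j0}^1)_j\in\mathbb R^{N_x}$. 5. Transformation. $\mathbf K^{\ast,\mathrm{trans}}=\mathrm{diag}(B_j^0/B_j^1)\,\widehat{\widehat{\mathbf X}}{}^\ast\widehat{\widehat{\mathbf S}}{}^\ast$, with QR decomposition $\mathbf K^{\ast,\mathrm{trans}}=\widehat{\widehat{\mathbf X}}{}^{\ast,\mathrm{trans}}\widehat{\widehat{\mathbf S}}{}^{\ast,\mathrm{trans}}$. 6. Augmentation. $\widehat{\widehat{\mathbf X}}{}^1=\mathrm{qr}([\mathbf v_0^1,\widehat{\widehat{\mathbf X}}{}^{\ast,\mathrm{trans}}])$, $\widehat{\widehat{\mathbf V}}{}^1=\mathrm{qr}([\mathbf e_1,\widehat{\widehat{\mathbf V}}{}^\ast])$ and $\widehat{\widehat{\mathbf S}}{}^1=\widehat{\widehat{\mathbf X}}{}^{1,\top}\widehat{\widehat{\mathbf X}}{}^{\ast,\mathrm{trans}}\widehat{\widehat{\mathbf S}}{}^{\ast,\mathrm{trans}}\widehat{\widehat{\mathbf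 V}}{}^{\ast,\top}(\mathbf I-\mathbf e_1\mathbf e_1^\top)\widehat{\widehat{\mathbf V}}{}^1+\widehat{\widehat{\mathbf X}}{}^{1,\top}\mathbf v_0^1\mathbf e_1^\top\widehat{\widehat{\mathbf V}}{}^1\in\mathbb R^{(4r+1)\times(4r+1)}$. 7. Conservative truncation with a tolerance $\vartheta\ge0$. Put $\widehat{\widehat{\mathbf K}}{}^1=\widehat{\widehat{\mathbf X}}{}^1\widehat{\widehat{\mathbf S}}{}^1=[\mathbf K^{\mathrm{cons}},\mathbf K^{\mathrm{rem}}]$ and $\widehat{\widehat{\mathbf V}}{}^1=[\mathbf e_1,\widehat{\widehat{\mathbf V}}{}^{\mathrm{rem}}]$ (first column, remaining columns). Set $\mathbf X^{\mathrm{cons}}=\mathbf K^{\mathrm{cons}}/\|\mathbf K^{\mathrm{cons}}\|$, $S^{\mathrm{cons}}=\|\mathbf K^{\mathrm{cons}}\|$ (any unit vector for $\mathbf X^{\mathrm{cons}}$ if $\mathbf K^{\mathrm{cons}}=0$). QR-decompose $\mathbf K^{\mathrm{rem}}=\widehat{\widehat{\mathbf X}}{}^{\mathrm{rem}}\widehat{\widehat{\mathbf S}}{}^{\mathrm{rem}}$, take the SVD $\widehat{\widehat{\mathbf S}}{}^{\mathrm{rem}}=\mathbf P\mathbf\Sigma\mathbf Q^\top$ with decreasingly ordered singular values $\sigma_j$, choose $r_1\le4r$ with $(\sum_{j=r_1+1}^{4r}\sigma_j^2)^{1/2}\le\vartheta$, let $\mathbf S^{\mathrm{rem}}$ be the diagonal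 matrix of the $r_1$ largest singular values, $\mathbf X^{\mathrm{rem}}=\widehat{\widehat{\mathbf X}}{}^{\mathrm{rem}}\mathbf P^{\mathrm{rem}}$, $\mathbf V^{\mathrm{rem}}=\widehat{\widehat{\mathbf V}}{}^{\mathrm{rem}}\mathbf Q^{\mathrm{rem}}$ with $\mathbf P^{\mathrm{rem}},\mathbf Q^{\mathrm{rem}}$ the first $r_1$ columns of $\mathbf P,\mathbf Q$. QR-decompose $[\mathbf X^{\mathrm{cons}},\mathbf X^{\mathrm{rem}}]=\mathbf X^1\mathbf R^1$ and $[\mathbf e_1,\mathbf V^{\mathrm{rem}}]=\mathbf V^1\mathbf R^2$ and set $\mathbf S^1=\mathbf R^1\begin{bmatrix}S^{\mathrm{cons}}&0\\0&\mathbf S^{\mathrm{rem}}\end{bmatrix}\mathbf R^{2,\top}$. The result of the step is $\mathbf B^1$ and $\mathbf v^1=\mathbf X^1\mathbf S^1\mathbf V^{1,\top}$. *)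

theory Defs
  imports "HOL-Analysis.Henstock_Kurzweil_Integration" "HOL-Computational_Algebra.Polynomial"
    "Jordan_Normal_Form.Matrix"
begin

unbundle no vec_syntax

section \<open>Matrices with orthonormal columns and decompositions\<close>

definition vnorm :: "real vec \<Rightarrow> real" where
  "vnorm v = sqrt (scalar_prod v v)"

definition col_mat :: "real vec \<Rightarrow> real mat" where
  "col_mat v = mat_of_cols (dim_vec v) [v]"

definition hcat :: "real mat \<Rightarrow> real mat \<Rightarrow> real mat" where
  "hcat A B = mat_of_cols (dim_row A) (cols A @ cols B)"

definition first_cols :: "nat \<Rightarrow> real mat \<Rightarrow> real mat" where
  "first_cols m A = mat_of_cols (dim_row A) (take m (cols A))"

definition tail_cols :: "real mat \<Rightarrow> real mat" where
  "tail_cols A = mat_of_cols (dim_row A) (tl (cols A))"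

definition mat_range :: "real mat \<Rightarrow> real vec set" where
  "mat_range A = (\<lambda>x. A *\<^sub>v x) ` carrier_vec (dim_col A)"

definition orthonormal_cols :: "real mat \<Rightarrow> bool" where
  "orthonormal_cols A \<longleftrightarrow> A\<^sup>T * A = 1\<^sub>m (dim_col A)"

text \<open>Matrix-valued operations that are only determined up to choices (orthonormal bases, QR and
  singular value decompositions) are rendered as relations; every admissible choice is covered.\<close>

definition is_qr :: "real mat \<Rightarrow> real mat \<Rightarrow> bool" where
  "is_qr Z Q \<longleftrightarrow>
     Q \<in> carrier_mat (dim_row Z) (dim_col Z) \<and> orthonormal_cols Q \<and>
     mat_range Z \<subseteq> mat_range Q \<and>
     (0 < dim_col Z \<and> col Z 0 \<noteq> 0\<^sub>v (dim_row Z) \<longrightarrow>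
        col Q 0 = (1 / vnorm (col Z 0)) \<cdot>\<^sub>v col Z 0)"

definition is_QR_decomp :: "real mat \<Rightarrow> real mat \<Rightarrow> real mat \<Rightarrow> bool" where
  "is_QR_decomp Z Q R \<longleftrightarrow>
     Q \<in> carrier_mat (dim_row Z) (dim_col Z) \<and> orthonormal_cols Q \<and>
     R \<in> carrier_mat (dim_col Z) (dim_col Z) \<and> upper_triangular R \<and> Z = Q * R"

definition is_SVD :: "nat \<Rightarrow> real mat \<Rightarrow> real mat \<Rightarrow> real mat \<Rightarrow> real mat \<Rightarrow> bool" where
  "is_SVD n S P \<Sigma> Q \<longleftrightarrow>
     P \<in> carrier_mat n n \<and> orthonormal_cols P \<and>
     Q \<in> carrier_mat n n \<and> orthonormal_cols Q \<and>
     \<Sigma> \<in> carrier_mat n n \<and> diagonal_mat \<Sigma> \<and>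
     (\<forall>j<n. 0 \<le> \<Sigma> $$ (j,j)) \<and>
     (\<forall>i j. i \<le> j \<and> j < n \<longrightarrow> \<Sigma> $$ (j,j) \<le> \<Sigma> $$ (i,i)) \<and>
     S = P * \<Sigma> * Q\<^sup>T"

text \<open>\<open>A = Q M Q\<^sup>T\<close> with \<open>Q\<close> orthogonal and \<open>M\<close> diagonal; the associated absolute value of \<open>A\<close> is
  \<open>Q |M| Q\<^sup>T\<close>, with \<open>|M|\<close> obtained by applying \<^term>\<open>abs\<close> to the entries of the diagonal
  matrix \<open>M\<close>.\<close>

definition is_spectral_decomp :: "nat \<Rightarrow> real mat \<Rightarrow> real mat \<Rightarrow> real mat \<Rightarrow> bool" where
  "is_spectral_decomp n A Q M \<longleftrightarrow>
     Q \<in> carrier_mat n n \<and> orthonormal_cols Q \<and>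
     M \<in> carrier_mat n n \<and> diagonal_mat M \<and> A = Q * M * Q\<^sup>T"

definition spectral_abs :: "real mat \<Rightarrow> real mat \<Rightarrow> real mat" where
  "spectral_abs Q M = Q * map_mat abs M * Q\<^sup>T"


section \<open>Angular and spatial discretization\<close>

text \<open>Legendre polynomials by Rodrigues' formula, then normalized in \<open>L\<^sup>2(-1,1)\<close>.\<close>

definition legendre :: "nat \<Rightarrow> real poly" where
  "legendre l = Polynomial.smult (1 / (2 ^ l * fact l)) ((pderiv ^^ l) ([:-1, 0, 1:] ^ l))"

definition legendre_normalized :: "nat \<Rightarrow> real poly" where
  "legendre_normalized l =
     Polynomial.smult (1 / sqrt (integral {-1..1} (\<lambda>\<mu>. (poly (legendre l) \<mu>)\<^sup>2))) (legendre l)"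

definition angular_matrix :: "nat \<Rightarrow> real mat" where
  "angular_matrix N = mat N N (\<lambda>(k,l). integral {-1..1}
     (\<lambda>\<mu>. \<mu> * poly (legendre_normalized k) \<mu> * poly (legendre_normalized l) \<mu>))"

text \<open>Spatial grid points are numbered from \<open>0\<close> to \<open>N - 1\<close>, with periodic indices: \<open>i\<close> is the
  right neighbour of \<open>j\<close> if \<open>i = (j + 1) mod N\<close> and the left one if \<open>j = (i + 1) mod N\<close>.\<close>

definition stencil_Dx :: "nat \<Rightarrow> real \<Rightarrow> real mat" where
  "stencil_Dx N dx = mat N N (\<lambda>(j,i).
     if i = (j + 1) mod N then 1 / (2 * dx)
     else if j = (i + 1) mod N then - 1 / (2 * dx)
     else 0)"

definition stencil_Dxx :: "nat \<Rightarrow> real \<Rightarrow> real mat" where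
  "stencil_Dxx N dx = mat N N (\<lambda>(j,i).
     if i = j then - 1 / dx
     else if i = (j + 1) mod N \<or> j = (i + 1) mod N then 1 / (2 * dx)
     else 0)"

text \<open>\<open>diag(B)\<^sup>-\<^sup>1 D diag(B)\<close>, meant for vectors \<open>B\<close> without zero entries.\<close>

definition diag_conj :: "nat \<Rightarrow> real vec \<Rightarrow> real mat \<Rightarrow> real mat" where
  "diag_conj N B D = mat_diag N (\<lambda>j. inverse (B $ j)) * D * mat_diag N (\<lambda>j. B $ j)"


section \<open>The time step\<close>

definition K_update ::
  "real \<Rightarrow> real \<Rightarrow> real mat \<Rightarrow> real mat \<Rightarrow> real mat \<Rightarrow> real mat \<Rightarrow>
   real mat \<Rightarrow> real mat \<Rightarrow> real mat \<Rightarrow> real mat" where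
  "K_update dt \<sigma> Gx Gxx A absA X0 S0 V0 =
     (let K0 = X0 * S0 in
      (1 / (1 + \<sigma> * dt)) \<cdot>\<^sub>m
        (K0 - dt \<cdot>\<^sub>m (Gx * K0 * V0\<^sup>T * A * V0) + dt \<cdot>\<^sub>m (Gxx * K0 * V0\<^sup>T * absA * V0)))"

definition L_update ::
  "real \<Rightarrow> real \<Rightarrow> real mat \<Rightarrow> real mat \<Rightarrow> real mat \<Rightarrow> real mat \<Rightarrow>
   real mat \<Rightarrow> real mat \<Rightarrow> real mat \<Rightarrow> real mat" where
  "L_update dt \<sigma> Gx Gxx A absA X0 S0 V0 =
     (let L0 = V0 * S0\<^sup>T in
      (1 / (1 + \<sigma> * dt)) \<cdot>\<^sub>m
        (L0 - dt \<cdot>\<^sub>m (A * L0 * X0\<^sup>T * Gx\<^sup>T * X0) + dt \<cdot>\<^sub>m (absA * L0 * X0\<^sup>T * Gxx\<^sup>T * X0)))"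

definition S_update ::
  "real \<Rightarrow> real \<Rightarrow> real mat \<Rightarrow> real mat \<Rightarrow> real mat \<Rightarrow> real mat \<Rightarrow>
   real mat \<Rightarrow> real mat \<Rightarrow> real mat \<Rightarrow> real mat" where
  "S_update dt \<sigma> Gx Gxx A absA X S V =
     (1 / (1 + \<sigma> * dt)) \<cdot>\<^sub>m
       (S - dt \<cdot>\<^sub>m (X\<^sup>T * Gx * X * S * V\<^sup>T * A * V)
          + dt \<cdot>\<^sub>m (X\<^sup>T * Gxx * X * S * V\<^sup>T * absA * V))"

text \<open>\<open>(X, S, V)\<close> are the augmented bases after the K- and L-steps and the projected coefficient
  matrix at the old time; \<open>v\<close> is the new zeroth moment.\<close>

definition coupled_update ::
  "nat \<Rightarrow> real \<Rightarrow> real \<Rightarrow> real mat \<Rightarrow> real mat \<Rightarrow> real mat \<Rightarrow> real mat \<Rightarrow>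
   real vec \<Rightarrow> real mat \<Rightarrow> real mat \<Rightarrow> real mat \<Rightarrow> real mat \<Rightarrow> real mat \<Rightarrow> real mat \<Rightarrow>
   real vec \<Rightarrow> real vec \<Rightarrow> bool" where
  "coupled_update Nx dt \<sigma> Gx Gxx A absA B0 X0 S0 V0 X S V v B1 \<longleftrightarrow>
     v \<in> carrier_vec Nx \<and> B1 \<in> carrier_vec Nx \<and>
     (\<forall>j<Nx.
        B1 $ j / B0 $ j * v $ j =
          1 / (1 + \<sigma> * dt) *
            ((X0 * S0 * V0\<^sup>T) $$ (j,0)
             - dt * (Gx * X * S * V\<^sup>T * A) $$ (j,0)
             + dt * (Gxx * X * S * V\<^sup>T * absA) $$ (j,0)
             + sqrt 2 * \<sigma> * dt * (B1 $ j / B0 $ j)) \<and>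
        B1 $ j / B0 $ j = 1 + \<sigma> * dt * (B1 $ j / B0 $ j) * (sqrt 2 * v $ j - 2))"

definition augmented_S ::
  "nat \<Rightarrow> real mat \<Rightarrow> real mat \<Rightarrow> real mat \<Rightarrow> real mat \<Rightarrow> real mat \<Rightarrow> real vec \<Rightarrow> real mat" where
  "augmented_S N\<mu> X1 V1 Xtrans Strans V v =
     (let e1 = col_mat (unit_vec N\<mu> 0) in
      X1\<^sup>T * Xtrans * Strans * V\<^sup>T * (1\<^sub>m N\<mu> - e1 * e1\<^sup>T) * V1
      + X1\<^sup>T * col_mat v * e1\<^sup>T * V1)"

text \<open>Conservative truncation of \<open>X S V\<^sup>T\<close>, where \<open>S\<close> has size \<open>m + 1\<close>, with tolerance \<open>\<theta>\<close>
  and truncated rank \<open>r1\<close> of the remainder. Singular values are numbered from \<open>0\<close>.\<close>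

definition conservative_truncation ::
  "nat \<Rightarrow> nat \<Rightarrow> nat \<Rightarrow> real \<Rightarrow> real mat \<Rightarrow> real mat \<Rightarrow> real mat \<Rightarrow>
   real mat \<Rightarrow> real mat \<Rightarrow> real mat \<Rightarrow> bool" where
  "conservative_truncation Nx N\<mu> m \<theta> X S V X1 S1 V1 \<longleftrightarrow>
     (\<exists>Kcons Krem Vrem Xcons Qrem Rrem P \<Sigma> Q r1 R1 R2.
        Kcons = col (X * S) 0 \<and> Krem = tail_cols (X * S) \<and> Vrem = tail_cols V \<and>
        Xcons \<in> carrier_vec Nx \<and> vnorm Xcons = 1 \<and>
        (Kcons \<noteq> 0\<^sub>v Nx \<longrightarrow> Xcons = (1 / vnorm Kcons) \<cdot>\<^sub>v Kcons) \<and>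
        is_QR_decomp Krem Qrem Rrem \<and>
        is_SVD m Rrem P \<Sigma> Q \<and>
        r1 \<le> m \<and> sqrt (\<Sum>j\<in>{r1..<m}. (\<Sigma> $$ (j,j))\<^sup>2) \<le> \<theta> \<and>
        is_QR_decomp (hcat (col_mat Xcons) (Qrem * first_cols r1 P)) X1 R1 \<and>
        is_QR_decomp (hcat (col_mat (unit_vec N\<mu> 0)) (Vrem * first_cols r1 Q)) V1 R2 \<and>
        S1 = R1 * four_block_mat (mat 1 1 (\<lambda>_. vnorm Kcons)) (0\<^sub>m 1 r1)
                    (0\<^sub>m r1 1) (mat_diag r1 (\<lambda>j. \<Sigma> $$ (j,j))) * R2\<^sup>T)"

text \<open>One step from \<open>(B0, X0, S0, V0)\<close> to \<open>(B1, X1, S1, V1)\<close>. Primes replace the hats: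
  \<open>X', V'\<close> are the bases augmented once and \<open>X'', V''\<close> those augmented twice; \<open>Y''\<close> and \<open>W''\<close>
  are the spatial and angular bases enlarged by the new zeroth moment and the first unit vector.\<close>

definition dlra_step ::
  "nat \<Rightarrow> nat \<Rightarrow> nat \<Rightarrow> real \<Rightarrow> real \<Rightarrow> real \<Rightarrow> real \<Rightarrow> real mat \<Rightarrow> real mat \<Rightarrow>
   real vec \<Rightarrow> real mat \<Rightarrow> real mat \<Rightarrow> real mat \<Rightarrow>
   real vec \<Rightarrow> real mat \<Rightarrow> real mat \<Rightarrow> real mat \<Rightarrow> bool" where
  "dlra_step Nx N\<mu> r dx dt \<sigma> \<theta> A absA B0 X0 S0 V0 B1 X1 S1 V1 \<longleftrightarrow>
     (\<exists>Gx Gxx X' X'' V' V'' S0t S'' v Xtrans Strans Y'' W''.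
        Gx = diag_conj Nx B0 (stencil_Dx Nx dx) \<and>
        Gxx = diag_conj Nx B0 (stencil_Dxx Nx dx) \<and>
        is_qr (hcat (K_update dt \<sigma> Gx Gxx A absA X0 S0 V0) X0) X' \<and>
        is_qr (hcat (hcat X' (Gx * X0)) (Gxx * X0)) X'' \<and>
        is_qr (hcat (L_update dt \<sigma> Gx Gxx A absA X0 S0 V0) V0) V' \<and>
        is_qr (hcat (hcat V' (A\<^sup>T * V0)) (absA\<^sup>T * V0)) V'' \<and>
        S0t = (X''\<^sup>T * X0) * S0 * (V''\<^sup>T * V0)\<^sup>T \<and>
        S'' = S_update dt \<sigma> Gx Gxx A absA X'' S0t V'' \<and>
        coupled_update Nx dt \<sigma> Gx Gxx A absA B0 X0 S0 V0 X'' S0t V'' v B1 \<and>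
        is_QR_decomp (mat_diag Nx (\<lambda>j. B0 $ j / B1 $ j) * X'' * S'') Xtrans Strans \<and>
        is_qr (hcat (col_mat v) Xtrans) Y'' \<and>
        is_qr (hcat (col_mat (unit_vec N\<mu> 0)) V'') W'' \<and>
        conservative_truncation Nx N\<mu> (4 * r) \<theta>
          Y'' (augmented_S N\<mu> Y'' W'' Xtrans Strans V'' v) W'' X1 S1 V1)"

end

theory Submission
  imports Defs
begin

text \<open>The coupled update is arranged so that \<open>\<surd>2\<close> times its first equation plus its second one
  cancels all terms in \<open>\<sigma>\<close>, leaving the balance law for the new moment \<open>v\<close>. It remains to see that
  the low-rank machinery is invisible in this balance: the augmented bases contain the old ones, so
  projecting the old solution changes nothing, and the truncation keeps the zeroth moment exactly,
  because \<open>e\<^sub>1\<close> is the first angular basis vector and all the others are orthogonal to it.\<close>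

section \<open>Columns and rows of concatenated matrices\<close>

lemma cols_hcat:
  assumes "dim_row A = dim_row B"
  shows "cols (hcat A B) = cols A @ cols B"
  unfolding hcat_def using assms cols_dim[of A] cols_dim[of B]
  by (intro cols_mat_of_cols) auto

lemma hcat_carrier:
  assumes "A \<in> carrier_mat n a" and "B \<in> carrier_mat n b"
  shows "hcat A B \<in> carrier_mat n (a + b)"
  using assms unfolding hcat_def by auto

lemma cols_col_mat: "cols (col_mat v) = [v]"
  unfolding col_mat_def by (intro cols_mat_of_cols) auto

lemma col_mat_carrier: "v \<in> carrier_vec n \<Longrightarrow> col_mat v \<in> carrier_mat n 1"
  unfolding col_mat_def by auto

lemma col_hcat_col_mat_0:
  assumes "v \<in> carrier_vec n" and "B \<in> carrier_mat n b"
  shows "col (hcat (col_mat v) B) 0 = v"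
proof -
  have "dim_row (col_mat v) = n" and "hcat (col_mat v) B \<in> carrier_mat n (1 + b)"
    using hcat_carrier[OF col_mat_carrier assms(2)] col_mat_carrier[of v n] assms by auto
  moreover from this have "cols (hcat (col_mat v) B) = v # cols B"
    using cols_hcat[of "col_mat v" B] assms by (auto simp: cols_col_mat)
  ultimately show ?thesis
    using cols_nth[of 0 "hcat (col_mat v) B"] by auto
qed

text \<open>Row 0 lists the zeroth Legendre coefficients of the basis vectors. For an angular basis
  that starts with the first unit vector, this says that only this vector carries the zeroth
  moment.\<close>

lemma row_hcat_unit_vec_0:
  assumes "B \<in> carrier_mat n b" and "0 < n" and "row B 0 = 0\<^sub>v b"
  shows "row (hcat (col_mat (unit_vec n 0)) B) 0 = unit_vec (1 + b) 0"
proof (rule eq_vecI)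
  let ?H = "hcat (col_mat (unit_vec n 0)) B"
  have H: "?H \<in> carrier_mat n (1 + b)"
    using hcat_carrier[OF col_mat_carrier assms(1)] by simp
  have dr: "dim_row (col_mat (unit_vec n 0)) = n" unfolding col_mat_def by simp
  show "dim_vec (row ?H 0) = dim_vec (unit_vec (1 + b) 0)" using H by simp
  fix i assume "i < dim_vec (unit_vec (1 + b) 0 :: real vec)"
  then have i: "i < 1 + b" by simp
  have "col ?H i = (unit_vec n 0 # cols B) ! i"
    using cols_nth[of i ?H] cols_hcat[of "col_mat (unit_vec n 0)" B] H i dr assms
    by (auto simp: cols_col_mat)
  then have "?H $$ (0, i) = (unit_vec n 0 # cols B) ! i $ 0"
    using H i assms(2) by (metis carrier_matD index_col)
  also have "\<dots> = unit_vec (1 + b) 0 $ i"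
  proof (cases i)
    case (Suc k)
    have "B $$ (0, k) = row B 0 $ k" using assms(1,2) Suc i by auto
    then have "B $$ (0, k) = 0" unfolding assms(3) using Suc i by simp
    then show ?thesis using assms(1,2) Suc i by (auto simp: unit_vec_def)
  qed (use assms in \<open>simp add: unit_vec_def\<close>)
  finally show "row ?H 0 $ i = unit_vec (1 + b) 0 $ i" using H i assms(2) by simp
qed

text \<open>Trades taking a column for a matrix-vector product, so that columns of long products can
  be followed by associativity.\<close>

lemma mult_mat_unit_vec:
  fixes A :: "real mat"
  assumes "A \<in> carrier_mat n m" and "k < m"
  shows "A *\<^sub>v unit_vec m k = col A k"
proof (rule eq_vecI)
  fix i assume "i < dim_vec (col A k)"
  then have "i < n" using assms by simp
  then show "(A *\<^sub>v unit_vec m k) $ i = col A k $ i"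
    using assms scalar_prod_right_unit[of k m "row A i"] by simp
qed (use assms in auto)

lemma tail_cols_carrier:
  assumes "A \<in> carrier_mat n (m + 1)"
  shows "tail_cols A \<in> carrier_mat n m"
  using assms unfolding tail_cols_def by auto

lemma index_tail_cols:
  assumes "A \<in> carrier_mat n (m + 1)" and "i < n" and "k < m"
  shows "tail_cols A $$ (i, k) = A $$ (i, Suc k)"
  using assms unfolding tail_cols_def by (auto simp: mat_of_cols_def nth_tl)

lemma first_cols_carrier:
  assumes "A \<in> carrier_mat n m" and "k \<le> m"
  shows "first_cols k A \<in> carrier_mat n k"
  using assms unfolding first_cols_def by auto

lemma vnorm_eq_0:
  assumes "vnorm v = 0"
  shows "v = 0\<^sub>v (dim_vec v)"
proof -
  have "(\<Sum>i = 0..<dim_vec v. v $ i * v $ i) = 0"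
    using assms unfolding vnorm_def scalar_prod_def by simp
  then have "\<forall>i < dim_vec v. v $ i * v $ i = 0"
    by (subst (asm) sum_nonneg_eq_0_iff) auto
  then show ?thesis by (intro eq_vecI) auto
qed

section \<open>Projections onto augmented bases\<close>

lemma is_qr_carrier:
  "is_qr Z Q \<Longrightarrow> Z \<in> carrier_mat n m \<Longrightarrow> Q \<in> carrier_mat n m"
  unfolding is_qr_def by auto

text \<open>A column of \<open>Z\<close> lies in the range of \<open>Z\<close>, hence in that of
  \<open>Q\<close>, so \<open>c = Q *\<^sub>v x\<close> for some \<open>x\<close>. Orthonormality
  then gives \<open>Q\<^sup>T *\<^sub>v c = x\<close>.\<close>

lemma is_qr_projection_vec:
  assumes qr: "is_qr Z Q" and Z: "Z \<in> carrier_mat n m" and c: "c \<in> set (cols Z)"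
  shows "Q *\<^sub>v (Q\<^sup>T *\<^sub>v c) = c"
proof -
  have Q: "Q \<in> carrier_mat n m" by (rule is_qr_carrier[OF qr Z])
  have QQ: "Q\<^sup>T * Q = 1\<^sub>m m" using qr Q unfolding is_qr_def orthonormal_cols_def by auto
  obtain k where k: "k < m" "c = col Z k"
    using c Z by (auto simp: cols_def)
  have "c = Z *\<^sub>v unit_vec m k" using k Z mult_mat_unit_vec[of Z n m k] by auto
  then have "c \<in> mat_range Z" unfolding mat_range_def using Z by auto
  then have "c \<in> mat_range Q" using qr unfolding is_qr_def by auto
  then obtain x where x: "x \<in> carrier_vec m" "c = Q *\<^sub>v x" unfolding mat_range_def using Q by auto
  have "Q\<^sup>T *\<^sub>v c = (Q\<^sup>T * Q) *\<^sub>v x" using x Q by (simp add: assoc_mult_mat_vec[of _ m n _ m])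
  then show ?thesis using x QQ by simp
qed

lemma is_qr_projection:
  assumes qr: "is_qr Z Q" and Z: "Z \<in> carrier_mat n m"
    and B: "B \<in> carrier_mat n b" and sub: "set (cols B) \<subseteq> set (cols Z)"
  shows "Q * Q\<^sup>T * B = B"
proof (rule mat_col_eqI)
  have Q: "Q \<in> carrier_mat n m" by (rule is_qr_carrier[OF qr Z])
  fix i assume "i < dim_col B"
  then have i: "i < b" "col B i \<in> set (cols Z)" using B sub by (auto simp: cols_def)
  have "col (Q * Q\<^sup>T * B) i = (Q * Q\<^sup>T) *\<^sub>v col B i"
    using Q B i by (intro col_mult2[of _ n n _ b]) auto
  also have "\<dots> = Q *\<^sub>v (Q\<^sup>T *\<^sub>v col B i)"
    using Q B i by (intro assoc_mult_mat_vec[of _ n m _ n]) auto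
  finally show "col (Q * Q\<^sup>T * B) i = col B i" using is_qr_projection_vec[OF qr Z i(2)] by simp
qed (use is_qr_carrier[OF qr Z] B in auto)

text \<open>The first augmentation lets \<open>B\<close> factor as \<open>Q\<close> times its
  coordinates \<open>Q\<^sup>T * B\<close>. The columns of \<open>Q\<close> are among those entering
  the second augmentation, so the second projector fixes \<open>Q\<close> and with it
  \<open>B\<close>.\<close>

lemma is_qr_projection_twice:
  assumes qr1: "is_qr Z Q" and Z: "Z \<in> carrier_mat n m"
    and qr2: "is_qr (hcat (hcat Q C) D) Q'" and C: "C \<in> carrier_mat n c" and D: "D \<in> carrier_mat n d"
    and B: "B \<in> carrier_mat n b" and sub: "set (cols B) \<subseteq> set (cols Z)"
  shows "Q' * Q'\<^sup>T * B = B"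
proof -
  let ?H = "hcat (hcat Q C) D"
  have Q: "Q \<in> carrier_mat n m" by (rule is_qr_carrier[OF qr1 Z])
  have H1: "hcat Q C \<in> carrier_mat n (m + c)" by (rule hcat_carrier[OF Q C])
  have H: "?H \<in> carrier_mat n (m + c + d)" by (rule hcat_carrier[OF H1 D])
  have Q': "Q' \<in> carrier_mat n (m + c + d)" by (rule is_qr_carrier[OF qr2 H])
  have cols: "cols ?H = cols Q @ cols C @ cols D"
    using cols_hcat[of "hcat Q C" D] cols_hcat[of Q C] Q C D H1 by auto
  have QB: "Q * (Q\<^sup>T * B) = B"
    using is_qr_projection[OF qr1 Z B sub] Q B by (simp add: assoc_mult_mat[of _ n m _ n _ b])
  have Q'Q: "Q' * Q'\<^sup>T * Q = Q"
    by (rule is_qr_projection[OF qr2 H Q]) (use cols in auto)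
  have "Q' * Q'\<^sup>T * B = Q' * Q'\<^sup>T * (Q * (Q\<^sup>T * B))" using QB by simp
  also have "\<dots> = (Q' * Q'\<^sup>T * Q) * (Q\<^sup>T * B)"
    using Q Q' B by (intro assoc_mult_mat[symmetric, of _ n n _ m _ b]) auto
  finally show ?thesis using Q'Q QB by simp
qed

text \<open>Regrouped, the left side is \<open>Y * Y\<^sup>T * X\<close> times \<open>S\<close>
  times the transpose of \<open>W * W\<^sup>T * V\<close>, and each projector fixes its basis. In
  this way the old solution is recovered from its coefficients in the larger bases.\<close>

lemma projected_product:
  fixes X Y V W S :: "real mat"
  assumes X: "X \<in> carrier_mat n r" and Y: "Y \<in> carrier_mat n p"
    and V: "V \<in> carrier_mat m r" and W: "W \<in> carrier_mat m q" and S: "S \<in> carrier_mat r r"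
    and XY: "Y * Y\<^sup>T * X = X" and VW: "W * W\<^sup>T * V = V"
  shows "Y * (Y\<^sup>T * X * S * (W\<^sup>T * V)\<^sup>T) * W\<^sup>T = X * S * V\<^sup>T"
proof -
  have T: "(W\<^sup>T * V)\<^sup>T = V\<^sup>T * W"
    using transpose_mult[of "W\<^sup>T" q m V r] V W by simp
  \<comment> \<open>The projector \<open>W * W\<^sup>T\<close> is symmetric, so transposing
    \<open>VW\<close> moves it to the right of \<open>V\<^sup>T\<close>, where the product needs
    it.\<close>
  have "(W * W\<^sup>T * V)\<^sup>T = V\<^sup>T * (W * W\<^sup>T)"
    using transpose_mult[of "W * W\<^sup>T" m m V r] transpose_mult[of W m q "W\<^sup>T" m] V W by simp
  then have VT: "V\<^sup>T * (W * W\<^sup>T) = V\<^sup>T" using VW by simp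
  have "Y * (Y\<^sup>T * X * S * (V\<^sup>T * W)) * W\<^sup>T = (Y * (Y\<^sup>T * X * S)) * ((V\<^sup>T * W) * W\<^sup>T)"
  proof -
    have "Y * (Y\<^sup>T * X * S * (V\<^sup>T * W)) = Y * (Y\<^sup>T * X * S) * (V\<^sup>T * W)"
      using X Y V W S by (intro assoc_mult_mat[symmetric, of _ n p _ r _ q]) auto
    then show ?thesis using X Y V W S by (simp add: assoc_mult_mat[of _ n r _ q _ m])
  qed
  also have "V\<^sup>T * W * W\<^sup>T = V\<^sup>T"
    using VT V W by (simp add: assoc_mult_mat[of _ r m _ q _ m])
  also have "Y * (Y\<^sup>T * X * S) = (Y * Y\<^sup>T * X) * S"
    using X Y S by (simp add: assoc_mult_mat[of _ p n _ r _ r] assoc_mult_mat[of _ n p _ n _ r]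
        assoc_mult_mat[of _ n p _ r _ r] assoc_mult_mat[of _ n n _ r _ r]
        assoc_mult_mat[of _ n r _ r _ r] assoc_mult_mat[of _ n p _ n _ n])
  finally show ?thesis using XY T by simp
qed

section \<open>The zeroth moment under truncation and augmentation\<close>

text \<open>The row-0 entry of a column is its inner product with the first unit vector, which is
  column 0 of \<open>W\<close>. Orthonormality makes it vanish for every column
  \<open>Suc k\<close>, and these are the columns of the tail.\<close>

lemma orthonormal_cols_row_0:
  assumes W: "W \<in> carrier_mat n (m + 1)" and "orthonormal_cols W"
    and c0: "col W 0 = unit_vec n 0" and n: "0 < n"
  shows "row (tail_cols W) 0 = 0\<^sub>v m"
proof (rule eq_vecI)
  have T: "tail_cols W \<in> carrier_mat n m" by (rule tail_cols_carrier[OF W])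
  have id: "W\<^sup>T * W = 1\<^sub>m (m + 1)" using assms(2) W unfolding orthonormal_cols_def by auto
  fix k assume "k < dim_vec (0\<^sub>v m :: real vec)"
  then have k: "k < m" by simp
  have "0 = (W\<^sup>T * W) $$ (0, Suc k)" using id k by simp
  also have "\<dots> = unit_vec n 0 \<bullet> col W (Suc k)" using W k c0 by simp
  also have "\<dots> = W $$ (0, Suc k)" using W k by (subst scalar_prod_left_unit[OF col_carrier_vec[OF _ W] n]) (auto simp: n)
  finally show "row (tail_cols W) 0 $ k = 0\<^sub>v m $ k"
    using T k n index_tail_cols[OF W n k] by simp
qed (use tail_cols_carrier[OF W] in auto)

text \<open>The singular value cut-off acts only on the remaining columns, whose angular vectors
  vanish in row 0. Reading off the zeroth moment therefore returns exactly the conserved column of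
  \<open>X * S\<close>.\<close>

lemma conservative_truncation_col_0:
  assumes tr: "conservative_truncation Nx N\<mu> m \<theta> X S V X1 S1 V1"
    and X: "X \<in> carrier_mat Nx (m + 1)" and S: "S \<in> carrier_mat (m + 1) (m + 1)"
    and V: "V \<in> carrier_mat N\<mu> (m + 1)" and oV: "orthonormal_cols V"
    and V0: "col V 0 = unit_vec N\<mu> 0" and N\<mu>: "0 < N\<mu>"
  shows "X1 * S1 * V1\<^sup>T \<in> carrier_mat Nx N\<mu>" and "col (X1 * S1 * V1\<^sup>T) 0 = X *\<^sub>v col S 0"
proof -
  obtain Kc Krem Vrem Xc Qrem Rrem P \<Sigma> Q r1 R1 R2 where
    defs: "Kc = col (X * S) 0" "Krem = tail_cols (X * S)" "Vrem = tail_cols V"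
    and Xc: "Xc \<in> carrier_vec Nx" "Kc \<noteq> 0\<^sub>v Nx \<Longrightarrow> Xc = (1 / vnorm Kc) \<cdot>\<^sub>v Kc"
    and qr: "is_QR_decomp Krem Qrem Rrem" and svd: "is_SVD m Rrem P \<Sigma> Q" and r1: "r1 \<le> m"
    and qr1: "is_QR_decomp (hcat (col_mat Xc) (Qrem * first_cols r1 P)) X1 R1"
    and qr2: "is_QR_decomp (hcat (col_mat (unit_vec N\<mu> 0)) (Vrem * first_cols r1 Q)) V1 R2"
    and S1: "S1 = R1 * four_block_mat (mat 1 1 (\<lambda>_. vnorm Kc)) (0\<^sub>m 1 r1)
                    (0\<^sub>m r1 1) (mat_diag r1 (\<lambda>j. \<Sigma> $$ (j,j))) * R2\<^sup>T"
    using tr unfolding conservative_truncation_def by blast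
  \<comment> \<open>\<open>H\<close> and \<open>W\<close> are the spatial and angular factors before
    the last orthonormalisation, and \<open>F\<close> is the block-diagonal core between
    them.\<close>
  define F where "F = four_block_mat (mat 1 1 (\<lambda>_. vnorm Kc)) (0\<^sub>m 1 r1)
                    (0\<^sub>m r1 1) (mat_diag r1 (\<lambda>j. \<Sigma> $$ (j,j)))"
  define H where "H = hcat (col_mat Xc) (Qrem * first_cols r1 P)"
  define W where "W = hcat (col_mat (unit_vec N\<mu> 0)) (Vrem * first_cols r1 Q)"
  have XS: "X * S \<in> carrier_mat Nx (m + 1)" using X S by auto
  have Kc: "Kc \<in> carrier_vec Nx" unfolding defs(1) using XS col_dim[of "X * S" 0] by auto
  have "Krem \<in> carrier_mat Nx m" unfolding defs using X S by (intro tail_cols_carrier) auto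
  then have "Qrem \<in> carrier_mat Nx m" using qr unfolding is_QR_decomp_def by auto
  moreover have "first_cols r1 P \<in> carrier_mat m r1" "first_cols r1 Q \<in> carrier_mat m r1"
    using svd r1 unfolding is_SVD_def by (auto intro: first_cols_carrier)
  moreover have Vrem: "Vrem \<in> carrier_mat N\<mu> m" unfolding defs by (rule tail_cols_carrier[OF V])
  ultimately have XR: "Qrem * first_cols r1 P \<in> carrier_mat Nx r1"
    and VR: "Vrem * first_cols r1 Q \<in> carrier_mat N\<mu> r1" and FQ: "first_cols r1 Q \<in> carrier_mat m r1"
    by auto
  have H: "H \<in> carrier_mat Nx (1 + r1)" and W: "W \<in> carrier_mat N\<mu> (1 + r1)"
    unfolding H_def W_def
    using hcat_carrier[OF col_mat_carrier XR] hcat_carrier[OF col_mat_carrier VR] Xc by auto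
  have F: "F \<in> carrier_mat (1 + r1) (1 + r1)" unfolding F_def
    by (intro four_block_carrier_mat) (simp_all add: mat_diag_def)
  have X1: "X1 \<in> carrier_mat Nx (1 + r1)" "R1 \<in> carrier_mat (1 + r1) (1 + r1)" "H = X1 * R1"
    using qr1 H unfolding is_QR_decomp_def H_def[symmetric] by auto
  have V1: "V1 \<in> carrier_mat N\<mu> (1 + r1)" "R2 \<in> carrier_mat (1 + r1) (1 + r1)" "W = V1 * R2"
    using qr2 W unfolding is_QR_decomp_def W_def[symmetric] by auto
  let ?p = "1 + r1"
  have WT: "R2\<^sup>T * V1\<^sup>T = W\<^sup>T" using V1 transpose_mult[of V1 N\<mu> ?p R2 ?p] by simp
  \<comment> \<open>The triangular factors in \<open>S1\<close> are absorbed again, since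
    \<open>X1 * R1 = H\<close> and \<open>R2\<^sup>T * V1\<^sup>T = W\<^sup>T\<close>. The last
    orthonormalisation thus leaves the represented matrix unchanged.\<close>
  have prod: "X1 * S1 * V1\<^sup>T = H * F * W\<^sup>T"
  proof -
    have "X1 * S1 = (X1 * (R1 * F)) * R2\<^sup>T"
      unfolding S1 F_def[symmetric] using X1 V1 F
      by (intro assoc_mult_mat[symmetric, of _ Nx ?p _ ?p _ ?p]) auto
    moreover have "X1 * (R1 * F) = H * F"
      unfolding X1(3) using X1 F by (intro assoc_mult_mat[symmetric, of _ Nx ?p _ ?p _ ?p]) auto
    ultimately show ?thesis
      using H F V1(1,2) unfolding WT[symmetric] by (simp add: assoc_mult_mat[of _ Nx ?p _ ?p _ N\<mu>])
  qed
  show "X1 * S1 * V1\<^sup>T \<in> carrier_mat Nx N\<mu>" using H F W unfolding prod by auto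
  \<comment> \<open>Combining the remaining angular vectors by right singular vectors keeps their
    row 0 equal to zero.\<close>
  have row: "row (Vrem * first_cols r1 Q) 0 = 0\<^sub>v r1"
  proof (rule eq_vecI)
    fix k assume "k < dim_vec (0\<^sub>v r1 :: real vec)"
    then have k: "k < r1" by simp
    have "row Vrem 0 = 0\<^sub>v m"
      unfolding defs by (rule orthonormal_cols_row_0[OF V oV V0 N\<mu>])
    then show "row (Vrem * first_cols r1 Q) 0 $ k = 0\<^sub>v r1 $ k"
      using Vrem FQ N\<mu> k by simp
  qed (use VR in auto)
  \<comment> \<open>Column 0 of \<open>W\<^sup>T\<close> being a unit vector, column 0 of
    \<open>H * F * W\<^sup>T\<close> reduces to the first column of \<open>H\<close>, weighted by
    the upper left entry of \<open>F\<close>.\<close>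
  have Wcol: "col W\<^sup>T 0 = unit_vec ?p 0"
    using row_hcat_unit_vec_0[OF VR N\<mu> row] W N\<mu> unfolding W_def[symmetric] by simp
  have Fcol: "col F 0 = vnorm Kc \<cdot>\<^sub>v unit_vec ?p 0"
    using F by (intro eq_vecI) (auto simp: F_def unit_vec_def)
  have "col (H * F * W\<^sup>T) 0 = (H * F) *\<^sub>v unit_vec ?p 0"
    using H F W N\<mu> Wcol col_mult2[of "H * F" Nx ?p "W\<^sup>T" N\<mu> 0] by simp
  also have "\<dots> = col (H * F) 0" using H F mult_mat_unit_vec[of "H * F" Nx ?p 0] by simp
  also have "\<dots> = H *\<^sub>v col F 0" using H F col_mult2[of H Nx ?p F ?p 0] by simp
  also have "\<dots> = vnorm Kc \<cdot>\<^sub>v (H *\<^sub>v unit_vec ?p 0)"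
    unfolding Fcol using H by (intro mult_mat_vec[of _ Nx ?p]) auto
  also have "H *\<^sub>v unit_vec ?p 0 = Xc"
    using H mult_mat_unit_vec[of H Nx ?p 0] col_hcat_col_mat_0[OF Xc(1) XR]
    unfolding H_def[symmetric] by simp
  \<comment> \<open>If the conserved column is zero, \<open>Xc\<close> is an arbitrary unit vector
    but its weight is 0. Otherwise normalising and rescaling undo each other.\<close>
  also have "vnorm Kc \<cdot>\<^sub>v Xc = Kc"
  proof (cases "Kc = 0\<^sub>v Nx")
    case True
    then show ?thesis using Xc by (auto simp: vnorm_def)
  next
    case False
    then have "vnorm Kc \<noteq> 0" using vnorm_eq_0[of Kc] Kc by auto
    then show ?thesis using Xc(2)[OF False] by (simp add: smult_smult_assoc)
  qed
  also have "Kc = X *\<^sub>v col S 0" unfolding defs using X S col_mult2[of X Nx "m + 1" S "m + 1" 0] by simp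
  finally show "col (X1 * S1 * V1\<^sup>T) 0 = X *\<^sub>v col S 0" unfolding prod .
qed

text \<open>Since column 0 of \<open>W\<close> is the first unit vector, column 0 of the augmented
  matrix results from applying the factors to this vector. The complementary projector annihilates
  it in the first summand, and the second summand returns the coordinates of \<open>v\<close>. The
  zeroth moment is thereby replaced by \<open>v\<close>.\<close>

lemma augmented_S_col_0:
  assumes Y: "Y \<in> carrier_mat Nx p" and W: "W \<in> carrier_mat N\<mu> p" and V: "V \<in> carrier_mat N\<mu> q"
    and Xt: "Xt \<in> carrier_mat Nx q" and St: "St \<in> carrier_mat q q" and v: "v \<in> carrier_vec Nx"
    and W0: "col W 0 = unit_vec N\<mu> 0" and N\<mu>: "0 < N\<mu>" and p: "0 < p"
  shows "augmented_S N\<mu> Y W Xt St V v \<in> carrier_mat p p"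
    and "col (augmented_S N\<mu> Y W Xt St V v) 0 = Y\<^sup>T *\<^sub>v v"
proof -
  let ?u = "unit_vec N\<mu> 0 :: real vec"
  define E where "E = col_mat ?u"
  define C where "C = col_mat v"
  define L where "L = Y\<^sup>T * Xt * St * V\<^sup>T"
  have E: "E \<in> carrier_mat N\<mu> 1" unfolding E_def by (intro col_mat_carrier) auto
  have C: "C \<in> carrier_mat Nx 1" unfolding C_def by (intro col_mat_carrier v)
  have L: "L \<in> carrier_mat p N\<mu>" unfolding L_def using Y Xt St V by auto
  have Sdef: "augmented_S N\<mu> Y W Xt St V v = L * (1\<^sub>m N\<mu> - E * E\<^sup>T) * W + Y\<^sup>T * C * E\<^sup>T * W"
    unfolding augmented_S_def Let_def E_def C_def L_def ..
  show "augmented_S N\<mu> Y W Xt St V v \<in> carrier_mat p p"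
    unfolding Sdef using L E C Y W by auto
  have c0E: "col E 0 = ?u"
    using cols_nth[of 0 E] E cols_col_mat[of ?u] unfolding E_def by auto
  have c0C: "col C 0 = v"
    using cols_nth[of 0 C] C cols_col_mat[of v] unfolding C_def by auto
  have Eu: "E\<^sup>T *\<^sub>v ?u = unit_vec 1 0"
    using E c0E N\<mu> by (intro eq_vecI) auto
  have Ee: "E *\<^sub>v unit_vec 1 0 = ?u" using mult_mat_unit_vec[OF E, of 0] c0E by simp
  have EEu: "(E * E\<^sup>T) *\<^sub>v ?u = ?u"
    using E Eu Ee by (simp add: assoc_mult_mat_vec[of _ N\<mu> 1 _ N\<mu>])
  have Z: "(1\<^sub>m N\<mu> - E * E\<^sup>T) *\<^sub>v ?u = 0\<^sub>v N\<mu>"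
    using E EEu by (subst minus_mult_distrib_mat_vec[of _ N\<mu> N\<mu>]) auto
  have LE: "L * (1\<^sub>m N\<mu> - E * E\<^sup>T) \<in> carrier_mat p N\<mu>"
    using L E by auto
  have "col (L * (1\<^sub>m N\<mu> - E * E\<^sup>T) * W) 0 = (L * (1\<^sub>m N\<mu> - E * E\<^sup>T)) *\<^sub>v ?u"
    using col_mult2[of "L * (1\<^sub>m N\<mu> - E * E\<^sup>T)" p N\<mu> W p 0] LE W W0 p by simp
  also have "\<dots> = L *\<^sub>v ((1\<^sub>m N\<mu> - E * E\<^sup>T) *\<^sub>v ?u)"
    using L E by (intro assoc_mult_mat_vec[of _ p N\<mu> _ N\<mu>]) auto
  also have "\<dots> = 0\<^sub>v p" unfolding Z using L by (intro eq_vecI) auto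
  finally have a: "col (L * (1\<^sub>m N\<mu> - E * E\<^sup>T) * W) 0 = 0\<^sub>v p" .
  have YC: "Y\<^sup>T * C \<in> carrier_mat p 1" using Y C by auto
  have "col (Y\<^sup>T * C * E\<^sup>T * W) 0 = (Y\<^sup>T * C * E\<^sup>T) *\<^sub>v ?u"
    using col_mult2[OF _ W p, of "Y\<^sup>T * C * E\<^sup>T" p] YC E unfolding W0 by auto
  also have "\<dots> = (Y\<^sup>T * C) *\<^sub>v unit_vec 1 0"
    using YC E Eu by (simp add: assoc_mult_mat_vec[of _ p 1 _ N\<mu>])
  also have "\<dots> = col (Y\<^sup>T * C) 0" using mult_mat_unit_vec[OF YC, of 0] by simp
  also have "\<dots> = Y\<^sup>T *\<^sub>v v" using col_mult2[of "Y\<^sup>T" p Nx C 1 0] Y C c0C by simp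
  finally have b: "col (Y\<^sup>T * C * E\<^sup>T * W) 0 = Y\<^sup>T *\<^sub>v v" .
  have "col (augmented_S N\<mu> Y W Xt St V v) 0
      = col (L * (1\<^sub>m N\<mu> - E * E\<^sup>T) * W) 0 + col (Y\<^sup>T * C * E\<^sup>T * W) 0"
    unfolding Sdef using LE E YC W p by (intro col_add) auto
  then show "col (augmented_S N\<mu> Y W Xt St V v) 0 = Y\<^sup>T *\<^sub>v v"
    unfolding a b using Y v by simp
qed

section \<open>Symmetry of the angular matrices and the discrete fluxes\<close>

text \<open>Exchanging the degrees only reorders the factors of the integrand.\<close>

lemma angular_matrix_symmetric: "(angular_matrix N)\<^sup>T = angular_matrix N"
  unfolding angular_matrix_def by (rule eq_matI) (auto simp: ac_simps)

text \<open>Transposition reverses the product \<open>Q * map_mat abs M * Q\<^sup>T\<close> into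
  itself because its middle factor is diagonal.\<close>

lemma spectral_abs_symmetric:
  assumes "is_spectral_decomp n A Q M"
  shows "spectral_abs Q M \<in> carrier_mat n n" and "(spectral_abs Q M)\<^sup>T = spectral_abs Q M"
proof -
  let ?M = "map_mat abs M"
  have Q: "Q \<in> carrier_mat n n" and M: "M \<in> carrier_mat n n" and d: "diagonal_mat M"
    using assms unfolding is_spectral_decomp_def by auto
  have M': "?M \<in> carrier_mat n n" using M by simp
  have MT: "?M\<^sup>T = ?M"
  \<comment> \<open>Since \<open>abs\<close> maps 0 to 0, the off-diagonal entries stay
    zero.\<close>
  proof (rule eq_matI)
    fix i j assume "i < dim_row ?M" "j < dim_col ?M"
    then show "?M\<^sup>T $$ (i, j) = ?M $$ (i, j)"
      using M d unfolding diagonal_mat_def by (cases "i = j") auto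
  qed (use M in auto)
  show "spectral_abs Q M \<in> carrier_mat n n" unfolding spectral_abs_def using Q M' by auto
  have "(Q * ?M * Q\<^sup>T)\<^sup>T = Q * (?M\<^sup>T * Q\<^sup>T)"
    using transpose_mult[of "Q * ?M" n n "Q\<^sup>T" n] transpose_mult[of Q n n ?M n] Q M' by simp
  also have "\<dots> = Q * ?M * Q\<^sup>T" unfolding MT using Q M' by (simp add: assoc_mult_mat[of _ n n _ n _ n])
  finally show "(spectral_abs Q M)\<^sup>T = spectral_abs Q M" unfolding spectral_abs_def .
qed

lemma diag_conj_carrier:
  "D \<in> carrier_mat n n \<Longrightarrow> diag_conj n B D \<in> carrier_mat n n"
  unfolding diag_conj_def by (intro mult_carrier_mat[of _ n n] mat_diag_dim)

lemma index_diag_conj: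
  assumes "D \<in> carrier_mat n n" and "j < n" and "i < n"
  shows "diag_conj n B D $$ (j, i) = inverse (B $ j) * D $$ (j, i) * B $ i"
  unfolding diag_conj_def using assms
  by (simp add: mat_diag_mult_left[of _ n n] mat_diag_mult_right[of _ n n])

text \<open>The factor \<open>B $ j\<close> cancels the inverse in row \<open>j\<close> of the
  conjugated stencil, which leaves the stencil acting on the products
  \<open>B $ i * u $$ (i, l)\<close>. Symmetry turns column 0 of \<open>A\<close>, as used by the
  scheme, into row 0, as used by the conservation law.\<close>

lemma diag_conj_flux:
  assumes D: "D \<in> carrier_mat n n" and u: "u \<in> carrier_mat n m" and A: "A \<in> carrier_mat m m"
    and sym: "A\<^sup>T = A" and j: "j < n" and m: "0 < m" and Bj: "B $ j \<noteq> 0"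
  shows "B $ j * (diag_conj n B D * u * A) $$ (j, 0)
    = (\<Sum>i<n. \<Sum>l<m. D $$ (j, i) * B $ i * u $$ (i, l) * A $$ (0, l))"
proof -
  have G: "diag_conj n B D \<in> carrier_mat n n" by (rule diag_conj_carrier[OF D])
  have A0: "A $$ (l, 0) = A $$ (0, l)" if "l < m" for l
  proof -
    have "A\<^sup>T $$ (0, l) = A $$ (l, 0)" using A m that by simp
    then show ?thesis using sym by simp
  qed
  have uA: "(u * A) $$ (i, 0) = (\<Sum>l<m. u $$ (i, l) * A $$ (0, l))" if "i < n" for i
    using that u A m A0 by (simp add: scalar_prod_def atLeast0LessThan)
  have "(diag_conj n B D * u * A) $$ (j, 0) = (diag_conj n B D * (u * A)) $$ (j, 0)"
    using G u A by (simp add: assoc_mult_mat[of _ n n _ m _ m])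
  also have "\<dots> = (\<Sum>i<n. diag_conj n B D $$ (j, i) * (u * A) $$ (i, 0))"
    using G u A j m by (simp add: scalar_prod_def atLeast0LessThan)
  also have "\<dots> = (\<Sum>i<n. inverse (B $ j) * (D $$ (j, i) * B $ i *
                      (\<Sum>l<m. u $$ (i, l) * A $$ (0, l))))"
    by (rule sum.cong) (simp_all add: index_diag_conj[OF D j] uA mult.assoc)
  finally show ?thesis
    using Bj by (simp add: sum_distrib_left[symmetric] mult.assoc)
qed

section \<open>The balance law and local mass conservation\<close>

text \<open>Here \<open>b\<close> is the ratio of new to old energy at one grid point. After
  clearing \<open>1 + s\<close>, the first equation times \<open>sqrt 2\<close> contributes
  \<open>2 * s * b\<close>, which cancels against the term \<open>- 2 * s * b\<close> of the second.
  The terms \<open>sqrt 2 * s * b * v\<close> on the two sides cancel as well.\<close>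

lemma coupled_update_balance:
  fixes b v \<phi> f h s dt :: real
  assumes "1 + s \<noteq> 0" and "s = \<sigma> * dt"
    and "b * v = 1 / (1 + s) * (\<phi> - dt * f + dt * h + sqrt 2 * \<sigma> * dt * b)"
    and "b = 1 + \<sigma> * dt * b * (sqrt 2 * v - 2)"
  shows "sqrt 2 * (b * v) + b = sqrt 2 * (\<phi> - dt * f + dt * h) + 1"
proof -
  let ?c = "sqrt 2 :: real"
  have c: "?c * ?c = 2" by simp
  have "(1 + s) * (b * v) = \<phi> - dt * f + dt * h + ?c * s * b"
    using assms(1) unfolding assms(3) by (simp add: assms(2))
  then have "?c * ((1 + s) * (b * v)) = ?c * (\<phi> - dt * f + dt * h) + (?c * ?c) * s * b"
    by (simp add: distrib_left mult.assoc)
  moreover have "b = 1 + s * b * (?c * v - 2)" using assms(4) by (simp add: assms(2))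
  ultimately show ?thesis unfolding c by (simp add: algebra_simps)
qed

theorem theorem4:
  fixes Nx N\<mu> r :: nat and dx dt \<sigma> \<theta> :: real
    and A absA Q M X0 S0 V0 X1 S1 V1 v0 :: "real mat" and B0 B1 :: "real vec"
    and \<Phi>0 \<Phi>1 :: "nat \<Rightarrow> real"
  assumes "3 \<le> Nx" and "1 \<le> r" and "4 * r + 1 \<le> min Nx N\<mu>"
    and "dx = 1 / real Nx" and "0 < dt" and "0 \<le> \<sigma>" and "0 \<le> \<theta>"
    and "A = angular_matrix N\<mu>"
    and "is_spectral_decomp N\<mu> A Q M" and "absA = spectral_abs Q M"
    and "B0 \<in> carrier_vec Nx" and "\<And>j. j < Nx \<Longrightarrow> B0 $ j \<noteq> 0"
    and "X0 \<in> carrier_mat Nx r" and "orthonormal_cols X0"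
    and "V0 \<in> carrier_mat N\<mu> r" and "orthonormal_cols V0"
    and "S0 \<in> carrier_mat r r"
    and "v0 = X0 * S0 * V0\<^sup>T"
    and "dlra_step Nx N\<mu> r dx dt \<sigma> \<theta> A absA B0 X0 S0 V0 B1 X1 S1 V1"
    and "\<And>j. \<Phi>0 j = (X0 * S0 * V0\<^sup>T) $$ (j,0)"
    and "\<And>j. \<Phi>1 j = (X1 * S1 * V1\<^sup>T) $$ (j,0)"
  shows "\<forall>j<Nx.
    1 / dt * (sqrt 2 * B1 $ j * \<Phi>1 j + B1 $ j - (sqrt 2 * B0 $ j * \<Phi>0 j + B0 $ j)) =
      - sqrt 2 * (\<Sum>i<Nx. \<Sum>l<N\<mu>. stencil_Dx Nx dx $$ (j,i) * B0 $ i * v0 $$ (i,l) * A $$ (0,l))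
      + sqrt 2 * (\<Sum>i<Nx. \<Sum>l<N\<mu>. stencil_Dxx Nx dx $$ (j,i) * B0 $ i * v0 $$ (i,l) * absA $$ (0,l))"
proof (intro allI impI)
  fix j assume j: "j < Nx"
  note X0 = assms(13) and V0 = assms(15) and S0 = assms(17)
  have N\<mu>: "0 < N\<mu>" using assms(3) by simp
  obtain Gx Gxx X' X'' V' V'' S0t S'' v Xtrans Strans Y'' W'' where
    Gx: "Gx = diag_conj Nx B0 (stencil_Dx Nx dx)" and
    Gxx: "Gxx = diag_conj Nx B0 (stencil_Dxx Nx dx)" and
    qX': "is_qr (hcat (K_update dt \<sigma> Gx Gxx A absA X0 S0 V0) X0) X'" and
    qX'': "is_qr (hcat (hcat X' (Gx * X0)) (Gxx * X0)) X''" and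
    qV': "is_qr (hcat (L_update dt \<sigma> Gx Gxx A absA X0 S0 V0) V0) V'" and
    qV'': "is_qr (hcat (hcat V' (A\<^sup>T * V0)) (absA\<^sup>T * V0)) V''" and
    S0t: "S0t = (X''\<^sup>T * X0) * S0 * (V''\<^sup>T * V0)\<^sup>T" and
    S'': "S'' = S_update dt \<sigma> Gx Gxx A absA X'' S0t V''" and
    coup: "coupled_update Nx dt \<sigma> Gx Gxx A absA B0 X0 S0 V0 X'' S0t V'' v B1" and
    qtrans: "is_QR_decomp (mat_diag Nx (\<lambda>j. B0 $ j / B1 $ j) * X'' * S'') Xtrans Strans" and
    qY: "is_qr (hcat (col_mat v) Xtrans) Y''" and
    qW: "is_qr (hcat (col_mat (unit_vec N\<mu> 0)) V'') W''" and
    trunc: "conservative_truncation Nx N\<mu> (4 * r) \<theta>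
          Y'' (augmented_S N\<mu> Y'' W'' Xtrans Strans V'' v) W'' X1 S1 V1"
    using assms(19) unfolding dlra_step_def by blast
  have A: "A \<in> carrier_mat N\<mu> N\<mu>" "A\<^sup>T = A"
    using angular_matrix_symmetric[of N\<mu>] unfolding assms(8) by (auto simp: angular_matrix_def)
  have absA: "absA \<in> carrier_mat N\<mu> N\<mu>" "absA\<^sup>T = absA"
    using spectral_abs_symmetric[OF assms(9)] unfolding assms(10) by auto
  have D: "stencil_Dx Nx dx \<in> carrier_mat Nx Nx" "stencil_Dxx Nx dx \<in> carrier_mat Nx Nx"
    unfolding stencil_Dx_def stencil_Dxx_def by auto
  have G: "Gx \<in> carrier_mat Nx Nx" "Gxx \<in> carrier_mat Nx Nx"
    unfolding Gx Gxx using D by (auto intro: diag_conj_carrier)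
  have K: "K_update dt \<sigma> Gx Gxx A absA X0 S0 V0 \<in> carrier_mat Nx r"
    using X0 V0 S0 G A absA unfolding K_update_def Let_def by auto
  have L: "L_update dt \<sigma> Gx Gxx A absA X0 S0 V0 \<in> carrier_mat N\<mu> r"
    using X0 V0 S0 G A absA unfolding L_update_def Let_def by auto
  have KX: "hcat (K_update dt \<sigma> Gx Gxx A absA X0 S0 V0) X0 \<in> carrier_mat Nx (r + r)"
    by (rule hcat_carrier[OF K X0])
  have LV: "hcat (L_update dt \<sigma> Gx Gxx A absA X0 S0 V0) V0 \<in> carrier_mat N\<mu> (r + r)"
    by (rule hcat_carrier[OF L V0])
  have cKX: "set (cols X0) \<subseteq> set (cols (hcat (K_update dt \<sigma> Gx Gxx A absA X0 S0 V0) X0))"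
    using K X0 by (subst cols_hcat) auto
  have cLV: "set (cols V0) \<subseteq> set (cols (hcat (L_update dt \<sigma> Gx Gxx A absA X0 S0 V0) V0))"
    using L V0 by (subst cols_hcat) auto
  have GX: "Gx * X0 \<in> carrier_mat Nx r" "Gxx * X0 \<in> carrier_mat Nx r" using G X0 by auto
  have AV: "A\<^sup>T * V0 \<in> carrier_mat N\<mu> r" "absA\<^sup>T * V0 \<in> carrier_mat N\<mu> r" using A absA V0 by auto
  have four: "4 * r = r + r + r + r" by simp
  have X'': "X'' \<in> carrier_mat Nx (4 * r)"
    using is_qr_carrier[OF qX'' hcat_carrier[OF hcat_carrier[OF is_qr_carrier[OF qX' KX] GX(1)] GX(2)]]
    by (simp add: four)
  have V'': "V'' \<in> carrier_mat N\<mu> (4 * r)"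
    using is_qr_carrier[OF qV'' hcat_carrier[OF hcat_carrier[OF is_qr_carrier[OF qV' LV] AV(1)] AV(2)]]
    by (simp add: four)
  \<comment> \<open>\<open>X0\<close> and \<open>V0\<close> enter the first augmentations as
    trailing blocks of columns, and the second augmentations enlarge the ranges further.\<close>
  have pX: "X'' * X''\<^sup>T * X0 = X0"
    by (rule is_qr_projection_twice[OF qX' KX qX'' GX X0 cKX])
  have pV: "V'' * V''\<^sup>T * V0 = V0"
    by (rule is_qr_projection_twice[OF qV' LV qV'' AV V0 cLV])
  have S0t_c: "S0t \<in> carrier_mat (4 * r) (4 * r)"
    unfolding S0t using X'' V'' X0 V0 S0 by auto
  have proj: "X'' * S0t * V''\<^sup>T = v0"
    unfolding S0t assms(18) by (rule projected_product[OF X0 X'' V0 V'' S0 pX pV])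
  have v0: "v0 \<in> carrier_mat Nx N\<mu>" unfolding assms(18) using X0 S0 V0 by auto
  \<comment> \<open>Both fluxes of the coupled update are written in the augmented bases; by
    \<open>proj\<close> they are the fluxes of \<open>v0\<close> itself.\<close>
  have flux_arg: "G' * X'' * S0t * V''\<^sup>T * A' = G' * v0 * A'"
    if "G' \<in> carrier_mat Nx Nx" for G' A' :: "real mat"
  proof -
    have "G' * X'' * S0t = G' * (X'' * S0t)"
      using that X'' S0t_c by (intro assoc_mult_mat[of _ Nx Nx _ "4 * r" _ "4 * r"]) auto
    moreover have "G' * (X'' * S0t) * V''\<^sup>T = G' * (X'' * S0t * V''\<^sup>T)"
      using that X'' S0t_c V'' by (intro assoc_mult_mat[of _ Nx Nx _ "4 * r" _ "N\<mu>"]) auto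
    ultimately show ?thesis using proj by simp
  qed
  have v: "v \<in> carrier_vec Nx" using coup unfolding coupled_update_def by blast
  have "S'' \<in> carrier_mat (4 * r) (4 * r)"
    unfolding S'' S_update_def using X'' V'' S0t_c G A absA by auto
  then have tr: "Xtrans \<in> carrier_mat Nx (4 * r)" "Strans \<in> carrier_mat (4 * r) (4 * r)"
    using qtrans X'' unfolding is_QR_decomp_def by (auto simp: mat_diag_def)
  have e1: "unit_vec N\<mu> 0 \<in> carrier_vec N\<mu>" by simp
  have HY: "hcat (col_mat v) Xtrans \<in> carrier_mat Nx (4 * r + 1)"
    using hcat_carrier[OF col_mat_carrier[OF v] tr(1)] by simp
  have HW: "hcat (col_mat (unit_vec N\<mu> 0)) V'' \<in> carrier_mat N\<mu> (4 * r + 1)"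
    using hcat_carrier[OF col_mat_carrier[OF e1] V''] by simp
  have Y'': "Y'' \<in> carrier_mat Nx (4 * r + 1)" by (rule is_qr_carrier[OF qY HY])
  have W'': "W'' \<in> carrier_mat N\<mu> (4 * r + 1)" by (rule is_qr_carrier[OF qW HW])
  have oW: "orthonormal_cols W''" using qW unfolding is_qr_def by blast
  have c0: "col (hcat (col_mat (unit_vec N\<mu> 0)) V'') 0 = unit_vec N\<mu> 0"
    by (rule col_hcat_col_mat_0[OF e1 V''])
  \<comment> \<open>The first column is fixed by \<open>is_qr\<close> only if the input column is
    nonzero. The unit vector is nonzero and has norm 1, so it is kept without rescaling.\<close>
  have nz: "unit_vec N\<mu> 0 \<noteq> (0\<^sub>v N\<mu> :: real vec)" using N\<mu> by simp
  have "vnorm (unit_vec N\<mu> 0) = 1"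
    using N\<mu> by (simp add: vnorm_def scalar_prod_left_unit[of _ N\<mu>])
  then have W0: "col W'' 0 = unit_vec N\<mu> 0"
    using qW nz HW c0 unfolding is_qr_def by auto
  \<comment> \<open>Membership among the orthonormalised columns is enough for this, and it includes
    the case that \<open>v\<close> is zero.\<close>
  have Y''v: "Y'' *\<^sub>v (Y''\<^sup>T *\<^sub>v v) = v"
  proof (rule is_qr_projection_vec[OF qY HY])
    show "v \<in> set (cols (hcat (col_mat v) Xtrans))"
      using tr v by (subst cols_hcat) (auto simp: cols_col_mat col_mat_def)
  qed
  note aug = augmented_S_col_0[OF Y'' W'' V'' tr v W0 N\<mu>, simplified]
  note trc = conservative_truncation_col_0[OF trunc Y'' _ W'' oW W0 N\<mu>, simplified, OF aug(1)[simplified]]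
  \<comment> \<open>Truncation keeps the conserved column, augmentation provides it as
    \<open>Y''\<^sup>T *\<^sub>v v\<close>, and \<open>Y''\<close> expands it back to
    \<open>v\<close>. The final zeroth moment is thus the one from the coupled update.\<close>
  have "\<Phi>1 j = col (X1 * S1 * V1\<^sup>T) 0 $ j"
    unfolding assms(21) using carrier_matD[OF trc(1)] j N\<mu> by (intro index_col[symmetric]) simp_all
  also have "\<dots> = v $ j" unfolding trc(2) aug(2) Y''v ..
  finally have \<Phi>1: "\<Phi>1 j = v $ j" .
  let ?b = "B1 $ j / B0 $ j"
  let ?F = "(Gx * v0 * A) $$ (j, 0)" and ?H = "(Gxx * v0 * absA) $$ (j, 0)"
  have Bj: "B0 $ j \<noteq> 0" by (rule assms(12)[OF j])
  have "1 + \<sigma> * dt \<noteq> 0" using assms(5,6) by (simp add: add_nonneg_eq_0_iff)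
  moreover have "?b * v $ j = 1 / (1 + \<sigma> * dt) * (\<Phi>0 j - dt * ?F + dt * ?H + sqrt 2 * \<sigma> * dt * ?b)"
    and "?b = 1 + \<sigma> * dt * ?b * (sqrt 2 * v $ j - 2)"
    using coup j unfolding coupled_update_def flux_arg[OF G(1)] flux_arg[OF G(2)] assms(20) by blast+
  ultimately have "sqrt 2 * (?b * v $ j) + ?b = sqrt 2 * (\<Phi>0 j - dt * ?F + dt * ?H) + 1"
    by (rule coupled_update_balance[OF _ refl])
  \<comment> \<open>Multiplication by \<open>B0 $ j\<close> turns the ratio \<open>?b\<close> into
    the new energy and the constant 1 into the old energy.\<close>
  then have "B0 $ j * (sqrt 2 * (?b * v $ j) + ?b) = B0 $ j * (sqrt 2 * (\<Phi>0 j - dt * ?F + dt * ?H) + 1)"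
    by simp
  moreover have "B0 $ j * (sqrt 2 * (?b * v $ j) + ?b) = sqrt 2 * B1 $ j * v $ j + B1 $ j"
    using Bj by (simp add: field_simps)
  ultimately have "sqrt 2 * B1 $ j * v $ j + B1 $ j - (sqrt 2 * B0 $ j * \<Phi>0 j + B0 $ j)
      = dt * (- sqrt 2 * (B0 $ j * ?F) + sqrt 2 * (B0 $ j * ?H))"
    by (simp add: algebra_simps)
  then have "1 / dt * (sqrt 2 * B1 $ j * \<Phi>1 j + B1 $ j - (sqrt 2 * B0 $ j * \<Phi>0 j + B0 $ j))
      = - sqrt 2 * (B0 $ j * ?F) + sqrt 2 * (B0 $ j * ?H)"
    unfolding \<Phi>1 using assms(5) by simp
  then show "1 / dt * (sqrt 2 * B1 $ j * \<Phi>1 j + B1 $ j - (sqrt 2 * B0 $ j * \<Phi>0 j + B0 $ j)) =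
      - sqrt 2 * (\<Sum>i<Nx. \<Sum>l<N\<mu>. stencil_Dx Nx dx $$ (j,i) * B0 $ i * v0 $$ (i,l) * A $$ (0,l))
      + sqrt 2 * (\<Sum>i<Nx. \<Sum>l<N\<mu>. stencil_Dxx Nx dx $$ (j,i) * B0 $ i * v0 $$ (i,l) * absA $$ (0,l))"
    unfolding Gx Gxx diag_conj_flux[OF D(1) v0 A j N\<mu> Bj] diag_conj_flux[OF D(2) v0 absA j N\<mu> Bj] .
qed

end
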